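(* Let $\mathbb{F}$ be a quadratically closed field with $\operatorname{char}\mathbb{F}\neq 2$, let $V$ be a finite-dimensional $\mathbb{F}$-vector space with $\dim V\ge 2$, let $b$ be a nondegenerate symmetric bilinear form on $V$ with $q(v):=b(v,v)$, and let $\mathcal{S}:=\mathcal{S}(V,b)$ be the associated spin factor. (a) If $\dim V\ge 3$, then $$\mathscr{P}(\mathcal{S})=(\mathcal{S}\setminus\mathbb{F}1)\cup\{0,1\},\qquad w(\mathcal{S})=3.$$ (b) If $\dim V=2$, then $$\mathscr{P}(\mathcal{S})=\{0,1\}\cup\{\alpha1+v:\alpha\in\mathbb{F},\ 0\neq v\in V,\ (\alpha,q(v))\neq(0,0)\}.$$ In this case $w(\mathcal{S})=4$, and the elements of length four (those $x\in\mathscr{P}(\mathcal{S})$ with $\ell_{\mathcal{S}}(x)=4$) are precisely $$-\tfrac18 1+v,\qquad 0\neq v\in V,\quad q(v)=0.$$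
   Context: A field of characteristic $\ne2$ is quadratically closed if every polynomial of degree two over it has a root in it (equivalently, every element is a square). The spin factor $\mathcal{S}(V,b)=\mathbb{F}1\oplus V$ is the Jordan algebra with unit $1$ and product $(\alpha1+u)\circ(\beta1+v)=(\alpha\beta+b(u,v))1+\alpha v+\beta u$ for $\alpha,\beta\in\mathbb{F}$, $u,v\in V$. Idempotent words: let $\mathcal{J}$ be a unital Jordan algebra with product $\circ$. An idempotent is $e\in\mathcal{J}$ with $e\circ e=e$. An idempotent word of length $m\ge 1$ is a left-nested product $(\cdots((e_1\circ e_2)\circ e_3)\circ\cdots)\circ e_m$ with all $e_i$ idempotents (for $m=1$ it is $e_1$). $\mathscr{P}(\mathcal{J})$ is the set of all values of idempotent words. For $x\in\mathscr{P}(\mathcal{J})$, $\ell_{\mathcal{J}}(x)$ is the minimal length of an idempotent word with value $x$, and $w(\mathcal{J})=\sup_{x\in\mathscr{P}(\mathcal{J})}\ell_{\mathcal{J}}(x)$. *)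

theory Defs
  imports
    "HOL-Computational_Algebra.Computational_Algebra"
    "HOL-Library.Extended_Nat"
    "HOL-Library.Product_Plus"
begin

section \<open>Quadratically closed fields and symmetric bilinear forms\<close>

definition quadratically_closed :: "'a::field itself \<Rightarrow> bool" where
  "quadratically_closed _ \<longleftrightarrow> (\<forall>p :: 'a poly. degree p = 2 \<longrightarrow> (\<exists>x. poly p x = 0))"

definition symmetric_bilinear_form ::
    "('a::field \<Rightarrow> 'v::ab_group_add \<Rightarrow> 'v) \<Rightarrow> ('v \<Rightarrow> 'v \<Rightarrow> 'a) \<Rightarrow> bool" where
  "symmetric_bilinear_form scale b \<longleftrightarrow>
     (\<forall>u. Vector_Spaces.linear scale (*) (b u)) \<and>
     (\<forall>v. Vector_Spaces.linear scale (*) (\<lambda>u. b u v)) \<and>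
     (\<forall>u v. b u v = b v u)"

definition nondegenerate :: "('v::zero \<Rightarrow> 'v \<Rightarrow> 'a::zero) \<Rightarrow> bool" where
  "nondegenerate b \<longleftrightarrow> (\<forall>u. (\<forall>v. b u v = 0) \<longrightarrow> u = 0)"


section \<open>Idempotent words\<close>

text \<open>
  The notions of this section are applied to unital Jordan algebras, but they depend only
  on the product, so they take just the product as their argument.
\<close>

definition idempotent :: "('j \<Rightarrow> 'j \<Rightarrow> 'j) \<Rightarrow> 'j \<Rightarrow> bool" where
  "idempotent prd e \<longleftrightarrow> prd e e = e"

definition idempotent_word :: "('j \<Rightarrow> 'j \<Rightarrow> 'j) \<Rightarrow> 'j list \<Rightarrow> bool" where
  "idempotent_word prd es \<longleftrightarrow> es \<noteq> [] \<and> (\<forall>e\<in>set es. idempotent prd e)"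

definition word_value :: "('j \<Rightarrow> 'j \<Rightarrow> 'j) \<Rightarrow> 'j list \<Rightarrow> 'j" where
  "word_value prd es = foldl prd (hd es) (tl es)"

definition idempotent_products :: "('j \<Rightarrow> 'j \<Rightarrow> 'j) \<Rightarrow> 'j set" where
  "idempotent_products prd = {word_value prd es | es. idempotent_word prd es}"

text \<open>Only meaningful for elements of \<^term>\<open>idempotent_products prd\<close>.\<close>

definition idempotent_length :: "('j \<Rightarrow> 'j \<Rightarrow> 'j) \<Rightarrow> 'j \<Rightarrow> nat" where
  "idempotent_length prd x =
     (LEAST m. \<exists>es. idempotent_word prd es \<and> length es = m \<and> word_value prd es = x)"

definition idempotent_width :: "('j \<Rightarrow> 'j \<Rightarrow> 'j) \<Rightarrow> enat" where
  "idempotent_width prd = (SUP x \<in> idempotent_products prd. enat (idempotent_length prd x))"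


section \<open>Spin factors\<close>

text \<open>The pair \<open>(\<alpha>, u)\<close> stands for \<open>\<alpha>1 + u\<close>; in particular the unit is \<open>(1, 0)\<close>.\<close>

fun spin_mult ::
    "('a::field \<Rightarrow> 'v::ab_group_add \<Rightarrow> 'v) \<Rightarrow> ('v \<Rightarrow> 'v \<Rightarrow> 'a) \<Rightarrow> 'a \<times> 'v \<Rightarrow> 'a \<times> 'v \<Rightarrow> 'a \<times> 'v" where
  "spin_mult scale b (\<alpha>, u) (\<beta>, v) = (\<alpha> * \<beta> + b u v, scale \<alpha> v + scale \<beta> u)"

definition spin_one :: "'a::field \<times> 'v::ab_group_add" where
  "spin_one = (1, 0)"

fun spin_scale ::
    "('a::field \<Rightarrow> 'v::ab_group_add \<Rightarrow> 'v) \<Rightarrow> 'a \<Rightarrow> 'a \<times> 'v \<Rightarrow> 'a \<times> 'v" where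
  "spin_scale scale c (\<alpha>, u) = (c * \<alpha>, scale c u)"

locale unital_jordan_algebra = vector_space scale
  for scale :: "'a::field \<Rightarrow> 'j::ab_group_add \<Rightarrow> 'j" +
  fixes prd :: "'j \<Rightarrow> 'j \<Rightarrow> 'j" and unit :: 'j
  assumes mult_add_left: "prd (x + y) z = prd x z + prd y z"
    and mult_scale_left: "prd (scale c x) y = scale c (prd x y)"
    and mult_commute: "prd x y = prd y x"
    and jordan_identity: "prd (prd x y) (prd x x) = prd x (prd y (prd x x))"
    and mult_unit: "prd unit x = x"

lemma spin_factor_unital_jordan_algebra:
  fixes scale :: "'a::field \<Rightarrow> 'v::ab_group_add \<Rightarrow> 'v"
  assumes "vector_space scale" and b: "symmetric_bilinear_form scale b"
  shows "unital_jordan_algebra (spin_scale scale) (spin_mult scale b) spin_one"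
proof -
  interpret vector_space scale by fact
  have lin: "Vector_Spaces.linear scale (*) (b u)" for u
    using b by (simp add: symmetric_bilinear_form_def)
  have sym: "b u v = b v u" for u v
    using b by (simp add: symmetric_bilinear_form_def)
  have add: "b u (v + w) = b u v + b u w" for u v w
    using lin by (rule Vector_Spaces.linear.axioms(3)[THEN module_hom.add])
  have add': "b (v + w) u = b v u + b w u" for u v w
    by (metis add sym)
  have scl: "b u (scale c v) = c * b u v" for u v c
    using lin by (rule Vector_Spaces.linear.axioms(3)[THEN module_hom.scale])
  have scl': "b (scale c v) u = c * b v u" for u v c
    by (metis scl sym)
  have zero: "b 0 u = 0" for u
    using scl'[of 0 0 u] by simp
  show ?thesis
  proof (unfold_locales, goal_cases)
    case (8 x y)
    obtain \<alpha> u \<beta> v where xy: "x = (\<alpha>, u)" "y = (\<beta>, v)"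
      by (cases x; cases y) auto
    have "b v u = b u v"
      by (rule sym)
    moreover have "scale (2 * c) w = scale c w + scale c w" for c w
      by (metis mult_2 scale_left_distrib)
    from this[of "\<alpha> * b u v" u]
    have "scale (\<alpha> * (2 * b u v)) u = scale (\<alpha> * b u v) u + scale (\<alpha> * b u v) u"
      by (simp add: mult.left_commute)
    ultimately show ?case
      by (simp add: xy add add' scl scl' algebra_simps)
  next
    case (7 x y)
    then show ?case
      by (cases x; cases y) (auto simp: sym mult.commute add.commute)
  qed (auto simp: spin_one_def add' scl' zero algebra_simps)
qed

end

theory Submission
  imports Defs
begin

text \<open>
  Write \<open>q v = b v v\<close>. Apart from \<open>0\<close> and \<open>1\<close>, the idempotents of the spin factor are
  \<open>1/2 + w/2\<close> with \<open>q w = 1\<close>. Right multiplication by such an idempotent is singular, and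
  its fibres are lines (\<open>prd_primitive_idempotent_iff\<close>): the equation
  \<open>x \<circ> (1/2 + w/2) = \<beta> + y\<close> is solvable iff \<open>b y w = \<beta>\<close>, and then the solutions are
  \<open>\<alpha> + (2y - \<alpha>w)\<close> with \<open>\<alpha>\<close> arbitrary. So a word for a given value is found by going
  backwards: choose at each step a unit vector \<open>w\<close> with \<open>b y w = \<beta>\<close> and a value of the free
  parameter \<open>\<alpha>\<close>.

  The choice of \<open>w\<close> is a question about quadratic forms. For \<open>y \<noteq> 0\<close> it is possible, except
  when the dimension is two and \<open>\<beta> = q y = 0\<close>: in the plane, a vector orthogonal to an
  isotropic \<open>y\<close> is a multiple of \<open>y\<close> and so is not a unit vector. For \<open>y = 0\<close> it forces
  \<open>\<beta> = 0\<close>. Together with the existence of short words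
  this determines the set of products.

  As to lengths, an element \<open>\<alpha> + v\<close> of length at most two, other than \<open>1\<close>, satisfies
  \<open>2 q v = \<alpha>\<close>, and this together with a unit vector \<open>u\<close> such that \<open>b v u = \<alpha>\<close> is also
  sufficient. For \<open>v = 2y - \<alpha>w\<close> the condition \<open>2 q v = \<alpha>\<close> becomes the quadratic equation
  \<open>2\<alpha>\<^sup>2 - (8\<beta> + 1)\<alpha> + 8 q y = 0\<close>,
  which has a root. Hence three factors suffice whenever \<open>u\<close> exists, in particular
  in dimension at least three. In dimension two \<open>u\<close> exists iff \<open>\<alpha> \<noteq> 0\<close>, and a nonzero root
  fails to exist exactly if \<open>q y = 0\<close> and \<open>\<beta> = -1/8\<close>. For these exceptional elements
  the parameter \<open>\<alpha> = -1\<close> leads back to an element with \<open>2 q v = 1\<close>, which is a product of three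
  idempotents, so four factors suffice.
\<close>

section \<open>Lengths of idempotent words\<close>

definition has_idempotent_word :: "('j \<Rightarrow> 'j \<Rightarrow> 'j) \<Rightarrow> nat \<Rightarrow> 'j \<Rightarrow> bool" where
  "has_idempotent_word prd m x \<longleftrightarrow>
     (\<exists>es. idempotent_word prd es \<and> length es = m \<and> word_value prd es = x)"

lemma has_idempotent_word_1: "has_idempotent_word prd (Suc 0) x \<longleftrightarrow> idempotent prd x"
proof
  assume "has_idempotent_word prd (Suc 0) x"
  then show "idempotent prd x"
    by (auto simp: has_idempotent_word_def idempotent_word_def word_value_def length_Suc_conv)
next
  assume "idempotent prd x"
  then have "idempotent_word prd [x] \<and> length [x] = Suc 0 \<and> word_value prd [x] = x"
    by (simp add: idempotent_word_def word_value_def)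
  then show "has_idempotent_word prd (Suc 0) x"
    unfolding has_idempotent_word_def by blast
qed

lemma has_idempotent_word_Suc:
  assumes "0 < m"
  shows "has_idempotent_word prd (Suc m) x \<longleftrightarrow>
    (\<exists>y e. has_idempotent_word prd m y \<and> idempotent prd e \<and> x = prd y e)"
proof
  assume "has_idempotent_word prd (Suc m) x"
  then obtain es where es: "idempotent_word prd es" "length es = Suc m" "word_value prd es = x"
    by (auto simp: has_idempotent_word_def)
  then obtain fs e where fs: "es = fs @ [e]"
    by (cases es rule: rev_cases) auto
  then have "length fs = m" "fs \<noteq> []"
    using es assms by auto
  moreover have "x = prd (word_value prd fs) e"
    using es fs \<open>fs \<noteq> []\<close> by (simp add: word_value_def)
  moreover have "idempotent_word prd fs" "idempotent prd e"
    using es fs \<open>fs \<noteq> []\<close> by (auto simp: idempotent_word_def)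
  ultimately show "\<exists>y e. has_idempotent_word prd m y \<and> idempotent prd e \<and> x = prd y e"
    unfolding has_idempotent_word_def by blast
next
  assume "\<exists>y e. has_idempotent_word prd m y \<and> idempotent prd e \<and> x = prd y e"
  then obtain fs e where fs: "idempotent_word prd fs" "length fs = m" "idempotent prd e"
      and x: "x = prd (word_value prd fs) e"
    by (auto simp: has_idempotent_word_def)
  have "idempotent_word prd (fs @ [e]) \<and> length (fs @ [e]) = Suc m
      \<and> word_value prd (fs @ [e]) = x"
    using fs x by (auto simp: idempotent_word_def word_value_def)
  then show "has_idempotent_word prd (Suc m) x"
    unfolding has_idempotent_word_def by blast
qed

lemma idempotent_products_iff_has_word:
  "x \<in> idempotent_products prd \<longleftrightarrow> (\<exists>m>0. has_idempotent_word prd m x)"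
  by (auto simp: idempotent_products_def has_idempotent_word_def idempotent_word_def)

lemma idempotent_products_induct [consumes 1, case_names idempotent step]:
  assumes "x \<in> idempotent_products prd"
    and "\<And>e. idempotent prd e \<Longrightarrow> P e"
    and "\<And>y e. P y \<Longrightarrow> idempotent prd e \<Longrightarrow> P (prd y e)"
  shows "P x"
proof -
  have "has_idempotent_word prd (Suc m) x \<Longrightarrow> P x" for m x
  proof (induction m arbitrary: x)
    case 0
    then show ?case using assms(2) by (simp add: has_idempotent_word_1)
  next
    case (Suc m)
    then show ?case using assms(3) by (auto simp: has_idempotent_word_Suc)
  qed
  then show ?thesis
    using assms(1) by (auto simp: idempotent_products_iff_has_word gr0_conv_Suc)
qed

text \<open>Words can be padded with the unit, so having a word of length \<open>m\<close> is monotone in \<open>m\<close>.\<close>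

lemma has_idempotent_word_mono:
  assumes "has_idempotent_word prd m x" "0 < m" "m \<le> n" "idempotent prd u" "\<And>y. prd y u = y"
  shows "has_idempotent_word prd n x"
  using assms(3)
proof (induction n rule: dec_induct)
  case base
  show ?case using assms by simp
next
  case (step n)
  then have "0 < n" using assms(2) by simp
  then show ?case
    using step.IH assms(4,5) unfolding has_idempotent_word_Suc[OF \<open>0 < n\<close>] by metis
qed

lemma idempotent_length_le_iff:
  assumes "x \<in> idempotent_products prd" "0 < m" "idempotent prd u" "\<And>y. prd y u = y"
  shows "idempotent_length prd x \<le> m \<longleftrightarrow> has_idempotent_word prd m x"
proof -
  have len: "idempotent_length prd x = (LEAST m. has_idempotent_word prd m x)"
    by (simp add: idempotent_length_def has_idempotent_word_def)
  have least: "has_idempotent_word prd (idempotent_length prd x) x"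
    using assms(1) unfolding len idempotent_products_iff_has_word by (metis LeastI)
  have pos: "0 < idempotent_length prd x"
    using least by (metis has_idempotent_word_def idempotent_word_def length_greater_0_conv)
  show ?thesis
  proof
    assume "idempotent_length prd x \<le> m"
    then show "has_idempotent_word prd m x"
      using has_idempotent_word_mono[OF least pos _ assms(3,4)] by blast
  next
    assume "has_idempotent_word prd m x"
    then show "idempotent_length prd x \<le> m"
      unfolding len by (rule Least_le)
  qed
qed

lemma idempotent_width_eqI:
  assumes "\<And>x. x \<in> idempotent_products prd \<Longrightarrow> idempotent_length prd x \<le> n"
    and "x \<in> idempotent_products prd" "idempotent_length prd x = n"
  shows "idempotent_width prd = enat n"
  unfolding idempotent_width_def
proof (rule antisym)
  show "(SUP x\<in>idempotent_products prd. enat (idempotent_length prd x)) \<le> enat n"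
    using assms(1) by (auto intro!: SUP_least)
  show "enat n \<le> (SUP x\<in>idempotent_products prd. enat (idempotent_length prd x))"
    using SUP_upper[OF assms(2), of "\<lambda>x. enat (idempotent_length prd x)"] assms(3) by simp
qed


section \<open>Values represented by a quadratic form\<close>

lemma quadratically_closed_root:
  assumes "quadratically_closed TYPE('a::field)"
  shows "\<exists>x::'a. x * x + p * x + r = 0"
proof -
  have "degree [:r, p, 1:] = 2" by simp
  then obtain x where "poly [:r, p, 1:] x = 0"
    using assms unfolding quadratically_closed_def by blast
  then show ?thesis by (auto simp: algebra_simps intro!: exI[of _ x])
qed

lemma two_neq_zero_if_CHAR_neq_two:
  assumes "CHAR('a::field) \<noteq> 2"
  shows "(2::'a) \<noteq> 0"
proof
  assume "(2::'a) = 0"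
  then have "CHAR('a) dvd 2"
    using of_nat_eq_0_iff_char_dvd[where 'a='a, of 2] by simp
  then have "CHAR('a) \<in> {1, 2}"
    using dvd_imp_le[of "CHAR('a)" 2] by (cases "CHAR('a) = 0") (auto simp: le_Suc_eq numeral_2_eq_2)
  then show False using assms by simp
qed

locale quadratic_space = finite_dimensional_vector_space scale Basis
  for scale :: "'a::field \<Rightarrow> 'v::ab_group_add \<Rightarrow> 'v" and Basis :: "'v set" +
  fixes b :: "'v \<Rightarrow> 'v \<Rightarrow> 'a"
  assumes quadratically_closed: "quadratically_closed TYPE('a)"
    and two: "(2::'a) \<noteq> 0"
    and bilinear: "symmetric_bilinear_form scale b"
    and nondegenerate: "nondegenerate b"
    and dim_ge_2: "dim UNIV \<ge> 2"
begin

lemma sym: "b u v = b v u"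
  using bilinear by (simp add: symmetric_bilinear_form_def)

lemma add_right [simp]: "b u (v + w) = b u v + b u w"
  using bilinear unfolding symmetric_bilinear_form_def
  by (metis Vector_Spaces.linear.axioms(3) module_hom.add)

lemma scale_right [simp]: "b u (scale c v) = c * b u v"
  using bilinear unfolding symmetric_bilinear_form_def
  by (metis Vector_Spaces.linear.axioms(3) module_hom.scale)

lemma add_left [simp]: "b (v + w) u = b v u + b w u"
  by (metis add_right sym)

lemma scale_left [simp]: "b (scale c v) u = c * b v u"
  by (metis scale_right sym)

lemma diff_right [simp]: "b u (v - w) = b u v - b u w"
  by (metis add_right add_diff_cancel_right' diff_add_cancel)

lemma diff_left [simp]: "b (v - w) u = b v u - b w u"
  by (metis diff_right sym)

lemma zero_right [simp]: "b u 0 = 0"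
  using diff_right[of u 0 0] by simp

lemma zero_left [simp]: "b 0 u = 0"
  by (metis sym zero_right)

lemma nondegenerateE:
  assumes "u \<noteq> 0"
  obtains v where "b u v = c"
proof -
  obtain v where "b u v \<noteq> 0"
    using nondegenerate assms unfolding nondegenerate_def by blast
  then have "b u (scale (c / b u v) v) = c" by simp
  then show thesis by (rule that)
qed

lemma exists_not_in_span:
  assumes "finite S" "card S < dim UNIV"
  obtains x where "x \<notin> span S"
  using dim_le_card[of UNIV S] assms by fastforce

lemma sqrt_exists: "\<exists>s. s * s = (c::'a)"
  using quadratically_closed_root[OF quadratically_closed, of 0 "-c"] by auto

text \<open>
  Over a quadratically closed field it is enough to find one anisotropic vector orthogonal to
  \<open>y\<close>, which can then be rescaled. If there were none, the form would vanish identically on the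
  hyperplane orthogonal to \<open>y\<close> by polarization. By nondegeneracy, the vectors orthogonal to
  that hyperplane are the multiples of \<open>y\<close>, and \<open>z\<close> would be one of them.
\<close>

lemma orthogonal_represents:
  assumes "y \<noteq> 0" and z: "b y z = 0" "z \<notin> span {y}"
  obtains w where "b y w = 0" "b w w = c"
proof -
  have "\<exists>w. b y w = 0 \<and> b w w \<noteq> 0"
  proof (rule ccontr)
    assume iso: "\<not> (\<exists>w. b y w = 0 \<and> b w w \<noteq> 0)"
    have perp: "b z v = 0" if "b y v = 0" for v
    proof -
      have "b y (z + v) = 0" using that z by simp
      then have "b (z + v) (z + v) = 0" "b z z = 0" "b v v = 0"
        using iso that z by blast+
      then have "2 * b z v = 0" by (simp add: sym[of v z])
      then show ?thesis using two by simp
    qed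
    obtain y' where y': "b y y' = 1" using nondegenerateE \<open>y \<noteq> 0\<close> .
    \<comment> \<open>The space is the sum of the hyperplane orthogonal to \<open>y\<close> and the line of \<open>y'\<close>;
      subtracting \<open>b z y' \<cdot> y\<close> makes the vector orthogonal to both.\<close>
    have "b (z - scale (b z y') y) v = 0" for v
    proof -
      have "b z (v - scale (b y v) y') = 0"
        by (rule perp) (simp add: y')
      then show ?thesis by simp
    qed
    then have "z = scale (b z y') y"
      using nondegenerate unfolding nondegenerate_def by (metis eq_iff_diff_eq_0)
    then show False
      using z(2) by (metis span_base span_scale singletonI)
  qed
  then obtain w where w: "b y w = 0" "b w w \<noteq> 0" by blast
  obtain s where "s * s = c / b w w" using sqrt_exists by blast
  then have "b (scale s w) (scale s w) = c" using w by (simp add: field_simps)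
  then show thesis using that[of "scale s w"] w by simp
qed

lemma orthogonal_represents_anisotropic:
  assumes "b y y \<noteq> 0"
  obtains w where "b y w = 0" "b w w = c"
proof -
  obtain x where x: "x \<notin> span {y}"
    using exists_not_in_span[of "{y}"] dim_ge_2 by auto
  define z where "z = x - scale (b y x / b y y) y"
  have "z \<notin> span {y}"
    using x unfolding z_def by (metis diff_add_cancel span_add span_base span_scale singletonI)
  moreover have "b y z = 0" using assms by (simp add: z_def)
  moreover have "y \<noteq> 0" using assms by auto
  ultimately show thesis using orthogonal_represents that by metis
qed

text \<open>
  For anisotropic \<open>y\<close> the component of \<open>w\<close> along \<open>y\<close> is prescribed, and an orthogonal
  summand corrects the norm. For isotropic \<open>y\<close> and \<open>\<beta> \<noteq> 0\<close>, adding \<open>\<gamma>y\<close> to any vector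
  with the right product changes its norm by \<open>2\<beta>\<gamma>\<close>, which takes every value.
\<close>

lemma unit_vector_with_product:
  assumes "y \<noteq> 0" "b y y \<noteq> 0 \<or> \<beta> \<noteq> 0"
  obtains w where "b w w = 1" "b y w = \<beta>"
proof (cases "b y y = 0")
  case False
  obtain z where z: "b y z = 0" "b z z = 1 - \<beta> * \<beta> / b y y"
    using orthogonal_represents_anisotropic[OF False] .
  define w where "w = scale (\<beta> / b y y) y + z"
  have "b w w = 1" "b y w = \<beta>"
    using z False by (simp_all add: w_def sym[of z y])
  then show thesis by (rule that)
next
  case True
  then have "\<beta> \<noteq> 0" using assms by simp
  obtain y' where y': "b y y' = \<beta>" using nondegenerateE[OF \<open>y \<noteq> 0\<close>] .
  define \<gamma> where "\<gamma> = (1 - b y' y') / (2 * \<beta>)"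
  have "b (y' + scale \<gamma> y) (y' + scale \<gamma> y) = b y' y' + \<gamma> * (2 * \<beta>)"
    using True y' by (simp add: sym[of y' y] algebra_simps)
  also have "\<dots> = 1" using two \<open>\<beta> \<noteq> 0\<close> by (simp add: \<gamma>_def)
  finally show thesis using that[of "y' + scale \<gamma> y"] True y' by simp
qed

text \<open>
  The additional case is that of an isotropic \<open>y\<close> with \<open>\<beta> = 0\<close>. The hyperplane orthogonal to
  \<open>y\<close> then has dimension at least two, so it is not contained in the line of \<open>y\<close>.
\<close>

lemma unit_vector_with_product_dim_ge_3:
  assumes "y \<noteq> 0" "dim UNIV \<ge> 3"
  obtains w where "b w w = 1" "b y w = \<beta>"
proof (cases "b y y \<noteq> 0 \<or> \<beta> \<noteq> 0")
  case True
  then show thesis using unit_vector_with_product assms(1) that by blast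
next
  case False
  obtain y' where y': "b y y' = 1" using nondegenerateE \<open>y \<noteq> 0\<close> .
  have "card {y, y'} \<le> 2" by (simp add: card_insert_if)
  then obtain x where x: "x \<notin> span {y, y'}"
    using exists_not_in_span[of "{y, y'}"] assms(2) by auto
  define z where "z = x - scale (b y x) y'"
  have "z \<notin> span {y}"
  proof
    assume "z \<in> span {y}"
    then have "z \<in> span {y, y'}" using span_mono[of "{y}" "{y, y'}"] by auto
    then have "z + scale (b y x) y' \<in> span {y, y'}"
      by (intro span_add span_scale) (auto intro: span_base)
    then show False using x by (simp add: z_def)
  qed
  moreover have "b y z = 0" by (simp add: z_def y')
  ultimately show thesis
    using orthogonal_represents[OF \<open>y \<noteq> 0\<close>, of z 1] False that by metis
qed

text \<open>
  In the plane, \<open>y\<close> and \<open>w\<close> would form a basis, and \<open>y\<close> would be orthogonal to both.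
\<close>

lemma isotropic_not_orthogonal_to_unit_vector:
  assumes "dim UNIV = 2" "y \<noteq> 0" "b y y = 0" "b w w = 1"
  shows "b y w \<noteq> 0"
proof
  assume "b y w = 0"
  have "w \<notin> span {y}"
  proof
    assume "w \<in> span {y}"
    then obtain k where "w = scale k y" by (auto simp: span_singleton)
    then show False using assms by simp
  qed
  then have "independent {w, y}" "w \<noteq> y"
    using assms by (auto simp: independent_insert span_base)
  then have "UNIV \<subseteq> span {w, y}"
    using card_ge_dim_independent[of "{w, y}" UNIV] assms(1) by simp
  moreover have "b y v = 0" if "v \<in> span {w, y}" for v
    using that assms(3) \<open>b y w = 0\<close>
    by (induction rule: span_induct_alt) auto
  ultimately show False
    using nondegenerate \<open>y \<noteq> 0\<close> unfolding nondegenerate_def by blast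
qed

lemma exists_nonzero: "\<exists>v::'v. v \<noteq> 0"
proof -
  obtain x where "x \<notin> span {0::'v}"
    using exists_not_in_span[of "{0}"] dim_ge_2 by auto
  then show ?thesis by (metis span_zero)
qed

text \<open>This provides elements of length four in the plane.\<close>

lemma exists_isotropic: "\<exists>v. v \<noteq> 0 \<and> b v v = 0"
proof -
  obtain y :: 'v where y: "y \<noteq> 0" using exists_nonzero by blast
  show ?thesis
  proof (cases "b y y = 0")
    case False
    obtain w where w: "b y w = 0" "b w w = - b y y"
      using orthogonal_represents_anisotropic[OF False] .
    have "b y (y + w) \<noteq> 0" using w False by simp
    then have "y + w \<noteq> 0" by (metis zero_right)
    moreover have "b (y + w) (y + w) = 0" using w by (simp add: sym[of w y])
    ultimately show ?thesis by blast
  qed (use y in blast)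
qed


section \<open>Multiplication by an idempotent of a spin factor\<close>

abbreviation prd where "prd \<equiv> spin_mult scale b"
abbreviation word where "word \<equiv> has_idempotent_word prd"

lemma eight: "(8::'a) \<noteq> 0"
proof -
  have "(8::'a) = 2 * (2 * 2)" by simp
  then show ?thesis using two by (metis mult_eq_0_iff)
qed

lemma idempotent_one: "idempotent prd spin_one"
  by (simp add: idempotent_def spin_one_def)

lemma idempotent_zero: "idempotent prd 0"
  by (simp add: idempotent_def zero_prod_def)

lemma prd_one: "prd x spin_one = x"
  by (cases x) (simp add: spin_one_def)

lemma prd_zero: "prd x 0 = 0"
  by (cases x) (simp add: zero_prod_def)

lemma one_prd: "prd spin_one x = x"
  by (cases x) (simp add: spin_one_def)

lemma idempotent_iff:
  "idempotent prd e \<longleftrightarrow>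
     e = 0 \<or> e = spin_one \<or> (\<exists>w. b w w = 1 \<and> e = (1 / 2, scale (1 / 2) w))"
proof
  obtain \<epsilon> u where e: "e = (\<epsilon>, u)" by (cases e)
  assume "idempotent prd e"
  then have eq: "\<epsilon> * \<epsilon> + b u u = \<epsilon>" and vec: "scale \<epsilon> u + scale \<epsilon> u = u"
    unfolding idempotent_def e by simp_all
  have "scale (2 * \<epsilon> - 1) u = 0"
    unfolding scale_left_diff_distrib mult_2 scale_left_distrib vec by simp
  then consider "u = 0" | "2 * \<epsilon> = 1" by auto
  then show "e = 0 \<or> e = spin_one \<or> (\<exists>w. b w w = 1 \<and> e = (1 / 2, scale (1 / 2) w))"
  proof cases
    case 1
    then have "\<epsilon> = 0 \<or> \<epsilon> = 1" using eq by simp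
    then show ?thesis using 1 by (auto simp: e spin_one_def zero_prod_def)
  next
    case 2
    have "b (scale 2 u) (scale 2 u) = 1"
    proof -
      have "b (scale 2 u) (scale 2 u) = 4 * b u u" by simp
      also have "b u u = \<epsilon> - \<epsilon> * \<epsilon>" using eq by (simp add: eq_diff_eq add.commute)
      also have "4 * (\<epsilon> - \<epsilon> * \<epsilon>) = 2 * (2 * \<epsilon>) - (2 * \<epsilon>) * (2 * \<epsilon>)"
        by (simp add: algebra_simps)
      also have "\<dots> = 1" unfolding 2 by simp
      finally show ?thesis .
    qed
    moreover have "\<epsilon> = 1 / 2" using 2 two by (simp add: field_simps)
    ultimately show ?thesis using two by (intro disjI2 exI[of _ "scale 2 u"]) (simp add: e)
  qed
next
  assume "e = 0 \<or> e = spin_one \<or> (\<exists>w. b w w = 1 \<and> e = (1 / 2, scale (1 / 2) w))"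
  moreover have "idempotent prd (h, scale h w)" if "b w w = 1" "h + h = 1" for h w
  proof -
    have "h * h + h * h = h" using that(2) by (metis distrib_left mult.right_neutral)
    then show ?thesis
      using that(1) by (simp add: idempotent_def scale_left_distrib[symmetric])
  qed
  moreover have "1 / 2 + 1 / 2 = (1::'a)" using two by (simp add: field_simps)
  ultimately show "idempotent prd e" using idempotent_one idempotent_zero by auto
qed

lemma idempotent_cases:
  assumes "idempotent prd (\<alpha>, v)"
  obtains "\<alpha> = 0" "v = 0" | "\<alpha> = 1" "v = 0" | "2 * \<alpha> = 1" "4 * b v v = 1"
proof -
  consider "(\<alpha>, v) = 0" | "(\<alpha>, v) = spin_one"
    | w where "b w w = 1" "(\<alpha>, v) = (1 / 2, scale (1 / 2) w)"
    using assms unfolding idempotent_iff by blast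
  then show thesis
  proof cases
    case (3 w)
    then have "2 * \<alpha> = 1" "w = scale 2 v" using two by (auto simp: mult.commute)
    moreover have "4 * b v v = b (scale 2 v) (scale 2 v)" by simp
    ultimately show thesis using 3(1) that(3) by simp
  qed (use that in \<open>simp_all add: zero_prod_def spin_one_def\<close>)
qed

text \<open>
  The vector part of the equation, doubled, determines \<open>v\<close> from \<open>\<alpha>\<close>; after substitution,
  \<open>\<alpha>\<close> cancels from the scalar part, because \<open>w\<close> is a unit vector.
\<close>

lemma prd_primitive_idempotent_iff:
  assumes w: "b w w = 1"
  shows "prd (\<alpha>, v) (1 / 2, scale (1 / 2) w) = (\<beta>, y) \<longleftrightarrow>
    b y w = \<beta> \<and> v = scale 2 y - scale \<alpha> w"
proof -
  have inj: "scale 2 s = scale 2 t \<longleftrightarrow> s = t" for s t using two by simp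
  have "scale \<alpha> (scale (1 / 2) w) + scale (1 / 2) v = y \<longleftrightarrow>
      scale 2 (scale \<alpha> (scale (1 / 2) w) + scale (1 / 2) v) = scale 2 y"
    by (simp only: inj)
  also have "\<dots> \<longleftrightarrow> v = scale 2 y - scale \<alpha> w"
    using two by (auto simp: scale_right_distrib algebra_simps)
  finally have vec: "scale \<alpha> (scale (1 / 2) w) + scale (1 / 2) v = y \<longleftrightarrow>
      v = scale 2 y - scale \<alpha> w" .
  have "\<alpha> * (1 / 2) + b v (scale (1 / 2) w) = \<beta> \<longleftrightarrow> b y w = \<beta>"
    if "v = scale 2 y - scale \<alpha> w"
    unfolding that using w two by (simp add: field_simps)
  then show ?thesis using vec by auto
qed

lemma quadratic_form_preimage:
  assumes "b w w = 1" "b y w = \<beta>" "v = scale 2 y - scale \<alpha> w"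
  shows "b v v = 4 * b y y - 4 * \<alpha> * \<beta> + \<alpha> * \<alpha>"
  unfolding assms(3) using assms(1,2) by (simp add: sym[of w y] algebra_simps)

lemma word_mono: "word m x \<Longrightarrow> 0 < m \<Longrightarrow> m \<le> n \<Longrightarrow> word n x"
  using has_idempotent_word_mono[OF _ _ _ idempotent_one prd_one] .

text \<open>
  The backward step of the search for words: the last factor is \<open>0\<close>, the unit, or a
  primitive idempotent, for which \<open>\<alpha>\<close> is the free parameter of the preimage.
\<close>

lemma word_Suc_iff:
  assumes "0 < m"
  shows "word (Suc m) (\<beta>, y) \<longleftrightarrow> (\<beta>, y) = 0 \<or> word m (\<beta>, y) \<or>
    (\<exists>w \<alpha>. b w w = 1 \<and> b y w = \<beta> \<and> word m (\<alpha>, scale 2 y - scale \<alpha> w))"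
    (is "?L \<longleftrightarrow> ?R")
proof
  assume ?L
  then obtain x e where x: "word m x" "idempotent prd e" "prd x e = (\<beta>, y)"
    using has_idempotent_word_Suc[OF assms] by metis
  obtain \<alpha> v where xv: "x = (\<alpha>, v)" by (cases x)
  consider "e = 0" | "e = spin_one" | w where "b w w = 1" "e = (1 / 2, scale (1 / 2) w)"
    using x(2) unfolding idempotent_iff by blast
  then show ?R
  proof cases
    case 3
    then show ?thesis
      using x prd_primitive_idempotent_iff[OF 3(1), of \<alpha> v \<beta> y] unfolding xv by blast
  qed (use x prd_one prd_zero in auto)
next
  assume ?R
  then consider "(\<beta>, y) = 0" | "word m (\<beta>, y)"
    | w \<alpha> where "b w w = 1" "b y w = \<beta>" "word m (\<alpha>, scale 2 y - scale \<alpha> w)"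
    by blast
  then show ?L
  proof cases
    case 1
    have "word (Suc 0) 0" by (simp add: has_idempotent_word_1 idempotent_zero)
    then show ?thesis using 1 word_mono[of "Suc 0" 0 "Suc m"] by simp
  next
    case 2
    then show ?thesis using word_mono[of m _ "Suc m"] assms by simp
  next
    case 3
    have "prd (\<alpha>, scale 2 y - scale \<alpha> w) (1 / 2, scale (1 / 2) w) = (\<beta>, y)"
      using prd_primitive_idempotent_iff[OF 3(1)] 3(2) by blast
    then show ?thesis
      using 3 idempotent_iff unfolding has_idempotent_word_Suc[OF assms] by metis
  qed
qed


section \<open>Values of words of length at most four\<close>

text \<open>
  The equation \<open>2 q y = \<beta>\<close> holds for every idempotent other than the unit. For products of two
  factors it results from comparing the norm \<open>q v = 1/4\<close> of the first factor with the norm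
  of the preimage for \<open>\<alpha> = 1/2\<close>.
\<close>

lemma word_2_quadratic_form:
  assumes "word 2 (\<beta>, y)"
  shows "(\<beta>, y) = spin_one \<or> 2 * b y y = \<beta>"
proof -
  consider "(\<beta>, y) = 0" | "word (Suc 0) (\<beta>, y)"
    | w \<alpha> where "b w w = 1" "b y w = \<beta>" "word (Suc 0) (\<alpha>, scale 2 y - scale \<alpha> w)"
    using assms word_Suc_iff[of "Suc 0"] by (auto simp: numeral_2_eq_2)
  then show ?thesis
  proof cases
    case 2
    then have "idempotent prd (\<beta>, y)" by (simp add: has_idempotent_word_1)
    then show ?thesis
    proof (cases rule: idempotent_cases)
      case 3
      then have "2 * (2 * b y y - \<beta>) = 0" by algebra
      then show ?thesis using two by (metis eq_iff_diff_eq_0 mult_eq_0_iff)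
    qed (simp_all add: spin_one_def)
  next
    case (3 w \<alpha>)
    let ?v = "scale 2 y - scale \<alpha> w"
    have q: "b ?v ?v = 4 * b y y - 4 * \<alpha> * \<beta> + \<alpha> * \<alpha>"
      using quadratic_form_preimage[OF 3(1,2) refl] .
    have "idempotent prd (\<alpha>, ?v)" using 3(3) by (simp add: has_idempotent_word_1)
    then show ?thesis
    proof (cases rule: idempotent_cases)
      case 1
      then have "y = 0" using two by simp
      then show ?thesis using 3(2) by simp
    next
      case 2
      have "w = scale 2 y" using 2 by simp
      then have "2 * b y y = \<beta>" using 3(2) by simp
      then show ?thesis by simp
    next
      case 3
      have "8 * (2 * b y y - \<beta>) = 0" using q 3 by algebra
      then show ?thesis using eight by (metis eq_iff_diff_eq_0 mult_eq_0_iff)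
    qed
  qed (simp add: zero_prod_def)
qed

text \<open>
  The parameter \<open>1/2\<close> of the preimage under \<open>1/2 + u/2\<close> is the only one that can give a
  primitive idempotent; the equation between \<open>q v\<close> and \<open>\<alpha>\<close> says that it does.
\<close>

lemma word_2I:
  assumes "2 * b v v = \<alpha>" "b u u = 1" "b v u = \<alpha>"
  shows "word 2 (\<alpha>, v)"
proof -
  define h where "h = (1 / 2 :: 'a)"
  define v' where "v' = scale 2 v - scale h u"
  have half: "2 * h = 1" using two by (simp add: h_def)
  have "b (scale 2 v') (scale 2 v') = 4 * b v' v'" by simp
  also have "\<dots> = 4 * (4 * b v v - 4 * h * \<alpha> + h * h)"
    using quadratic_form_preimage[OF assms(2,3) v'_def] by metis
  also have "\<dots> = 1" using half assms(1) by algebra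
  finally have "idempotent prd (1 / 2, scale (1 / 2) (scale 2 v'))"
    unfolding idempotent_iff by blast
  then have "word (Suc 0) (h, v')"
    using two by (simp add: has_idempotent_word_1 h_def)
  then show ?thesis
    using word_Suc_iff[of "Suc 0" \<alpha> v] assms by (auto simp: numeral_2_eq_2 v'_def)
qed

text \<open>
  The quadratic equation for \<open>\<alpha>\<close> expresses that the preimage \<open>\<alpha> + v\<close> satisfies
  \<open>2 q v = \<alpha>\<close>. Its vector part is nonzero, since \<open>v = 0\<close> would imply \<open>\<alpha> = 0\<close> and then
  \<open>y = 0\<close>. Whether a unit vector \<open>u\<close> with \<open>b v u = \<alpha>\<close> exists depends on the dimension, so
  this is left as a hypothesis.
\<close>

lemma word_3I:
  assumes "y \<noteq> 0" "b w w = 1" "b y w = \<beta>"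
    and root: "2 * \<alpha> * \<alpha> - (8 * \<beta> + 1) * \<alpha> + 8 * b y y = 0"
    and attained: "\<And>v. v \<noteq> 0 \<Longrightarrow> 2 * b v v = \<alpha> \<Longrightarrow> \<exists>u. b u u = 1 \<and> b v u = \<alpha>"
  shows "word 3 (\<beta>, y)"
proof -
  define v where "v = scale 2 y - scale \<alpha> w"
  have "2 * b v v = 2 * (4 * b y y - 4 * \<alpha> * \<beta> + \<alpha> * \<alpha>)"
    using quadratic_form_preimage[OF assms(2,3) v_def] by simp
  also have "\<dots> = \<alpha>" using root by algebra
  finally have q: "2 * b v v = \<alpha>" .
  have "v \<noteq> 0"
  proof
    assume "v = 0"
    moreover from this have "\<alpha> = 0" using q by (metis mult_zero_right zero_right)
    ultimately show False using two \<open>y \<noteq> 0\<close> by (simp add: v_def)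
  qed
  then obtain u where "b u u = 1" "b v u = \<alpha>" using attained[OF _ q] by blast
  then have "word 2 (\<alpha>, v)" using word_2I[OF q] by blast
  then show ?thesis
    using word_Suc_iff[of 2 \<beta> y] assms(2,3) by (auto simp: v_def)
qed

lemma root_exists: "\<exists>\<alpha>. 2 * \<alpha> * \<alpha> - s * \<alpha> + t = (0::'a)"
proof -
  obtain \<alpha> where "\<alpha> * \<alpha> + (- s / 2) * \<alpha> + t / 2 = 0"
    using quadratically_closed_root[OF quadratically_closed] by blast
  then have "2 * (\<alpha> * \<alpha> + (- s / 2) * \<alpha> + t / 2) = 0" by simp
  then show ?thesis using two by (intro exI[of _ \<alpha>]) (simp add: algebra_simps)
qed

text \<open>
  A last factor \<open>1/2 + w/2\<close> leaves the witness \<open>w\<close> in the value \<open>b v w + v\<close>. Keeping this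
  witness, rather than only \<open>v \<noteq> 0\<close>, serves all dimensions: in the plane it excludes that
  \<open>b v w\<close> and \<open>q v\<close> both vanish.
\<close>

lemma idempotent_products_imp_nonscalar:
  assumes "x \<in> idempotent_products prd"
  shows "x = 0 \<or> x = spin_one \<or> (\<exists>v w. v \<noteq> 0 \<and> b w w = 1 \<and> x = (b v w, v))"
    (is "?P x")
  using assms
proof (induction rule: idempotent_products_induct)
  have idem: "?P e" if e: "idempotent prd e" for e
  proof -
    consider "e = 0" | "e = spin_one" | w where "b w w = 1" "e = (1 / 2, scale (1 / 2) w)"
      using e unfolding idempotent_iff by blast
    then show ?thesis
    proof cases
      case (3 w)
      then have "w \<noteq> 0" by auto
      then have "scale (1 / 2) w \<noteq> 0" "e = (b (scale (1 / 2) w) w, scale (1 / 2) w)"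
        using 3 two by auto
      then show ?thesis using 3(1) by blast
    qed simp_all
  qed
  {
    case (idempotent e)
    then show ?case by (rule idem)
  next
    case (step x e)
    consider "e = 0" | "e = spin_one" | "x = spin_one"
      | w where "b w w = 1" "e = (1 / 2, scale (1 / 2) w)"
      using step(2) unfolding idempotent_iff by blast
    then show ?case
    proof cases
      case 3
      then show ?thesis using idem[OF step(2)] by (simp only: one_prd)
    next
      case (4 w)
      obtain \<alpha> v \<beta> y where xy: "x = (\<alpha>, v)" "prd x e = (\<beta>, y)"
        by (metis surj_pair)
      then have "b y w = \<beta>"
        using prd_primitive_idempotent_iff[OF 4(1), of \<alpha> v \<beta> y] 4(2) by simp
      then show ?thesis using 4(1) xy(2) by (cases "y = 0") (auto simp: zero_prod_def)
    qed (use step(1) in \<open>simp_all only: prd_zero prd_one simp_thms\<close>)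
  }
qed

lemma zero_one_products: "0 \<in> idempotent_products prd" "spin_one \<in> idempotent_products prd"
  using idempotent_zero idempotent_one
  by (auto simp: idempotent_products_iff_has_word has_idempotent_word_1 intro!: exI[of _ "Suc 0"])

lemma word_zero_one: "word (Suc m) 0" "word (Suc m) spin_one"
  using word_mono[of "Suc 0" _ "Suc m"] idempotent_zero idempotent_one
  by (auto simp: has_idempotent_word_1)

lemma length_le_iff:
  "x \<in> idempotent_products prd \<Longrightarrow> 0 < m \<Longrightarrow> idempotent_length prd x \<le> m \<longleftrightarrow> word m x"
  by (rule idempotent_length_le_iff[OF _ _ idempotent_one prd_one])

lemma word_imp_product: "word m x \<Longrightarrow> 0 < m \<Longrightarrow> x \<in> idempotent_products prd"
  unfolding idempotent_products_iff_has_word by blast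


section \<open>Dimension at least three\<close>

lemma word_3_dim_ge_3:
  assumes "dim UNIV \<ge> 3" "y \<noteq> 0"
  shows "word 3 (\<beta>, y)"
proof -
  obtain w where w: "b w w = 1" "b y w = \<beta>"
    using unit_vector_with_product_dim_ge_3[OF assms(2,1)] .
  obtain \<alpha> where "2 * \<alpha> * \<alpha> - (8 * \<beta> + 1) * \<alpha> + 8 * b y y = 0"
    using root_exists by blast
  then show ?thesis
    using word_3I[OF assms(2) w] unit_vector_with_product_dim_ge_3[OF _ assms(1)] by metis
qed

lemma idempotent_products_dim_ge_3:
  assumes "dim UNIV \<ge> 3"
  shows "idempotent_products prd
    = (UNIV - range (\<lambda>\<alpha>. spin_scale scale \<alpha> spin_one)) \<union> {0, spin_one}"
proof -
  have scalars: "(\<beta>, y) \<in> range (\<lambda>\<alpha>. spin_scale scale \<alpha> spin_one) \<longleftrightarrow> y = 0" for \<beta> y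
    by (auto simp: spin_one_def image_iff)
  show ?thesis
  proof (intro equalityI subsetI)
    fix x assume "x \<in> idempotent_products prd"
    then have "x = 0 \<or> x = spin_one \<or> snd x \<noteq> 0"
      using idempotent_products_imp_nonscalar[of x] by auto
    then show "x \<in> (UNIV - range (\<lambda>\<alpha>. spin_scale scale \<alpha> spin_one)) \<union> {0, spin_one}"
      using scalars[of "fst x" "snd x"] by simp
  next
    fix x assume "x \<in> (UNIV - range (\<lambda>\<alpha>. spin_scale scale \<alpha> spin_one)) \<union> {0, spin_one}"
    then show "x \<in> idempotent_products prd"
      using zero_one_products word_3_dim_ge_3[OF assms] word_imp_product[of 3] scalars
      by (cases x) auto
  qed
qed

lemma idempotent_width_dim_ge_3:
  assumes "dim UNIV \<ge> 3"
  shows "idempotent_width prd = 3"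
proof -
  have le: "idempotent_length prd x \<le> 3" if "x \<in> idempotent_products prd" for x
    using that idempotent_products_imp_nonscalar[OF that] word_zero_one[of 2]
      word_3_dim_ge_3[OF assms]
    by (subst length_le_iff) (auto simp: numeral_3_eq_3)
  obtain v :: 'v where v: "v \<noteq> 0" using exists_nonzero by blast
  \<comment> \<open>The scalar part is chosen to violate the equation that holds for length at most two.\<close>
  let ?x = "(2 * b v v + 1, v)"
  have x: "?x \<in> idempotent_products prd"
    using word_imp_product[OF word_3_dim_ge_3[OF assms v]] by simp
  have "\<not> word 2 ?x"
    using word_2_quadratic_form[of "2 * b v v + 1" v] v by (auto simp: spin_one_def)
  then have "\<not> idempotent_length prd ?x \<le> 2" using length_le_iff[OF x] by simp
  then have "idempotent_length prd ?x = 3" using le[OF x] by linarith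
  then show ?thesis
    using idempotent_width_eqI[OF le x] by (simp add: numeral_eq_enat)
qed


section \<open>Dimension two\<close>

text \<open>
  A nonzero root \<open>\<alpha>\<close> of the quadratic equation is needed, because in the plane \<open>\<alpha> \<noteq> 0\<close> is what
  guarantees the unit vector \<open>u\<close>. If \<open>q y \<noteq> 0\<close>, zero is not a root. If \<open>q y = 0\<close>, the roots
  are \<open>0\<close> and \<open>(8\<beta> + 1)/2\<close>.
\<close>

lemma word_3_dim_2:
  assumes "y \<noteq> 0" "(\<beta>, b y y) \<noteq> (0, 0)" "(\<beta>, b y y) \<noteq> (- (1 / 8), 0)"
  shows "word 3 (\<beta>, y)"
proof -
  obtain w where w: "b w w = 1" "b y w = \<beta>"
    using unit_vector_with_product[OF assms(1), of \<beta>] assms(2) by auto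
  have "\<exists>\<alpha>. 2 * \<alpha> * \<alpha> - (8 * \<beta> + 1) * \<alpha> + 8 * b y y = 0 \<and> \<alpha> \<noteq> 0"
  proof (cases "b y y = 0")
    case True
    then have "\<beta> \<noteq> - (1 / 8)" using assms(3) by simp
    then have "8 * \<beta> + 1 \<noteq> 0"
      using eight by (auto simp: field_simps add_eq_0_iff)
    moreover define \<alpha> where "\<alpha> = (8 * \<beta> + 1) / 2"
    moreover have "2 * \<alpha> = 8 * \<beta> + 1" using two by (simp add: \<alpha>_def)
    ultimately show ?thesis using True by (intro exI[of _ \<alpha>]) auto
  next
    case False
    then show ?thesis
      using root_exists[of "8 * \<beta> + 1" "8 * b y y"] eight by auto
  qed
  then obtain \<alpha> where \<alpha>: "2 * \<alpha> * \<alpha> - (8 * \<beta> + 1) * \<alpha> + 8 * b y y = 0" "\<alpha> \<noteq> 0" by blast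
  show ?thesis
    using word_3I[OF assms(1) w \<alpha>(1)] unit_vector_with_product \<alpha>(2) by metis
qed

text \<open>
  Here the preimage \<open>\<alpha> + v\<close> has \<open>q v = \<alpha>\<^sup>2 + \<alpha>/2\<close>, and \<open>\<alpha>\<close> is free. The choice
  \<open>\<alpha> = -1\<close> makes \<open>q v = 1/2\<close> nonzero in every characteristic other than two, so the preimage
  is not exceptional.
\<close>

lemma word_4_dim_2:
  assumes "y \<noteq> 0" "b y y = 0"
  shows "word 4 (- (1 / 8), y)"
proof -
  define \<beta> where "\<beta> = (- (1 / 8) :: 'a)"
  have \<beta>: "8 * \<beta> = - 1" "\<beta> \<noteq> 0" using eight by (simp_all add: \<beta>_def)
  obtain w where w: "b w w = 1" "b y w = \<beta>"
    using unit_vector_with_product[OF assms(1), of \<beta>] \<beta>(2) by blast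
  define v where "v = scale 2 y - scale (- 1) w"
  have "2 * b v v = 1"
    using quadratic_form_preimage[OF w v_def] assms(2) \<beta>(1) by algebra
  then have "b v v \<noteq> 0" by (metis mult_zero_right zero_neq_one_class.zero_neq_one)
  moreover from this have "v \<noteq> 0" by (metis zero_left)
  ultimately have "word 3 (- 1, v)" by (intro word_3_dim_2) simp_all
  moreover have "0 < (3::nat)" by simp
  ultimately have "word (Suc 3) (\<beta>, y)"
    using word_Suc_iff[of 3 \<beta> y] w unfolding v_def by blast
  then show ?thesis by (simp add: \<beta>_def)
qed

lemma idempotent_products_dim_2:
  assumes "dim UNIV = 2"
  shows "idempotent_products prd
    = {0, spin_one} \<union> {(\<alpha>, v) | \<alpha> v. v \<noteq> 0 \<and> (\<alpha>, b v v) \<noteq> (0, 0)}"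
proof (intro equalityI subsetI)
  fix x assume "x \<in> idempotent_products prd"
  then show "x \<in> {0, spin_one} \<union> {(\<alpha>, v) | \<alpha> v. v \<noteq> 0 \<and> (\<alpha>, b v v) \<noteq> (0, 0)}"
    using idempotent_products_imp_nonscalar[of x] isotropic_not_orthogonal_to_unit_vector[OF assms]
    by auto
next
  fix x :: "'a \<times> 'v"
  assume "x \<in> {0, spin_one} \<union> {(\<alpha>, v) | \<alpha> v. v \<noteq> 0 \<and> (\<alpha>, b v v) \<noteq> (0, 0)}"
  then consider "x = 0" | "x = spin_one"
    | \<alpha> v where "x = (\<alpha>, v)" "v \<noteq> 0" "(\<alpha>, b v v) \<noteq> (0, 0)" by blast
  then show "x \<in> idempotent_products prd"
  proof cases
    case 3
    then have "word 3 x \<or> word 4 x" using word_3_dim_2 word_4_dim_2 by auto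
    then show ?thesis using word_imp_product[of _ x] by auto
  qed (use zero_one_products in auto)
qed

text \<open>
  For these elements, zero is the only root of the quadratic equation. The preimage of length at
  most two is not the unit, because \<open>w = 2y\<close> would be isotropic; it would therefore be the isotropic vector \<open>2y\<close> without scalar part, which is not a
  product of idempotents at all.
\<close>

lemma not_word_3_dim_2:
  assumes "dim UNIV = 2" "y \<noteq> 0" "b y y = 0"
  shows "\<not> word 3 (- (1 / 8), y)"
proof
  assume word: "word 3 (- (1 / 8), y)"
  have "\<not> word 2 (- (1 / 8), y)"
    using word_2_quadratic_form[of "- (1 / 8)" y] assms eight
    by (auto simp: spin_one_def)
  then obtain w \<alpha> where w: "b w w = 1" "b y w = - (1 / 8)" "word 2 (\<alpha>, scale 2 y - scale \<alpha> w)"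
    using word word_Suc_iff[of 2 "- (1 / 8)" y] assms(2) by (auto simp: zero_prod_def)
  let ?v = "scale 2 y - scale \<alpha> w"
  have "(\<alpha>, ?v) \<noteq> spin_one"
  proof
    assume "(\<alpha>, ?v) = spin_one"
    then have "w = scale 2 y" by (auto simp: spin_one_def)
    then show False using w(1) assms(3) by simp
  qed
  then have "2 * b ?v ?v = \<alpha>" using word_2_quadratic_form[OF w(3)] by blast
  moreover have "2 * b ?v ?v = 2 * \<alpha> * \<alpha> + \<alpha>"
  proof -
    have "8 * b y w = - 1" using w(2) eight by simp
    then show ?thesis
      using quadratic_form_preimage[OF w(1) refl refl, of y \<alpha>] assms(3) by algebra
  qed
  ultimately have "\<alpha> = 0" using two by simp
  then have "word 2 (0, scale 2 y)" using w(3) by simp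
  then have "(0, scale 2 y) \<in> idempotent_products prd" by (rule word_imp_product) simp
  then show False
    using idempotent_products_dim_2[OF assms(1)] assms(2,3) two
    by (auto simp: zero_prod_def spin_one_def)
qed

lemma length_le_4_dim_2:
  assumes "dim UNIV = 2" "x \<in> idempotent_products prd"
  shows "idempotent_length prd x \<le> 4"
    and "idempotent_length prd x \<le> 3 \<longleftrightarrow> x \<notin> {(- (1 / 8), v) | v. v \<noteq> 0 \<and> b v v = 0}"
proof -
  let ?E = "{(- (1 / 8), v) | v. v \<noteq> 0 \<and> b v v = 0}"
  have word_3: "word 3 x \<longleftrightarrow> x \<notin> ?E"
  proof
    assume "x \<notin> ?E"
    then consider "x = 0" | "x = spin_one"
      | \<alpha> v where "x = (\<alpha>, v)" "v \<noteq> 0" "(\<alpha>, b v v) \<noteq> (0, 0)"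
      using assms(2) unfolding idempotent_products_dim_2[OF assms(1)] by blast
    then show "word 3 x"
    proof cases
      case (3 \<alpha> v)
      then have "(\<alpha>, b v v) \<noteq> (- (1 / 8), 0)" using \<open>x \<notin> ?E\<close> by auto
      then show ?thesis using word_3_dim_2 3 by blast
    qed (use word_zero_one[of 2] in \<open>simp_all add: numeral_3_eq_3\<close>)
  qed (use not_word_3_dim_2[OF assms(1)] in blast)
  then show "idempotent_length prd x \<le> 3 \<longleftrightarrow> x \<notin> ?E"
    using length_le_iff[OF assms(2)] by simp
  have "word 4 x" if "x \<in> ?E"
    using that word_4_dim_2 by blast
  moreover have "word 3 x \<Longrightarrow> word 4 x" using word_mono[of 3 x 4] by simp
  ultimately have "word 4 x" using word_3 by blast
  then show "idempotent_length prd x \<le> 4"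
    using length_le_iff[OF assms(2)] by simp
qed

lemma length_eq_4_dim_2:
  assumes "dim UNIV = 2"
  shows "{x \<in> idempotent_products prd. idempotent_length prd x = 4}
    = {(- (1 / 8), v) | v. v \<noteq> 0 \<and> b v v = 0}"
proof -
  have "{(- (1 / 8), v) | v. v \<noteq> 0 \<and> b v v = 0} \<subseteq> idempotent_products prd"
    using word_4_dim_2 word_imp_product[of 4] by auto
  moreover have "idempotent_length prd x = 4 \<longleftrightarrow> x \<in> {(- (1 / 8), v) | v. v \<noteq> 0 \<and> b v v = 0}"
    if "x \<in> idempotent_products prd" for x
    using length_le_4_dim_2[OF assms that] by linarith
  ultimately show ?thesis by blast
qed

lemma idempotent_width_dim_2:
  assumes "dim UNIV = 2"
  shows "idempotent_width prd = 4"
proof -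
  obtain v where "v \<noteq> 0" "b v v = 0" using exists_isotropic by blast
  then have "(- (1 / 8), v) \<in> {x \<in> idempotent_products prd. idempotent_length prd x = 4}"
    unfolding length_eq_4_dim_2[OF assms] by blast
  then show ?thesis
    using idempotent_width_eqI[OF length_le_4_dim_2(1)[OF assms]] by (auto simp: numeral_eq_enat)
qed

end

theorem theorem3p2:
  fixes scale :: "'a::field \<Rightarrow> 'v::ab_group_add \<Rightarrow> 'v"
    and Basis :: "'v set"
    and b :: "'v \<Rightarrow> 'v \<Rightarrow> 'a"
  assumes "quadratically_closed TYPE('a)"
    and "CHAR('a) \<noteq> 2"
    and "finite_dimensional_vector_space scale Basis"
    and "vector_space.dim scale (UNIV :: 'v set) \<ge> 2"
    and "symmetric_bilinear_form scale b"
    and "nondegenerate b"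
  shows
    "(vector_space.dim scale (UNIV :: 'v set) \<ge> 3 \<longrightarrow>
        idempotent_products (spin_mult scale b)
          = (UNIV - range (\<lambda>\<alpha>. spin_scale scale \<alpha> spin_one)) \<union> {0, spin_one}
        \<and> idempotent_width (spin_mult scale b) = 3)
     \<and>
     (vector_space.dim scale (UNIV :: 'v set) = 2 \<longrightarrow>
        idempotent_products (spin_mult scale b)
          = {0, spin_one} \<union> {(\<alpha>, v) | \<alpha> v. v \<noteq> 0 \<and> (\<alpha>, b v v) \<noteq> (0, 0)}
        \<and> idempotent_width (spin_mult scale b) = 4
        \<and> {x \<in> idempotent_products (spin_mult scale b). idempotent_length (spin_mult scale b) x = 4}
            = {(- (1 / 8), v) | v. v \<noteq> 0 \<and> b v v = 0})"
proof -
  interpret quadratic_space scale Basis b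
    using assms two_neq_zero_if_CHAR_neq_two
    by (intro quadratic_space.intro quadratic_space_axioms.intro)
  show ?thesis
    using idempotent_products_dim_ge_3 idempotent_width_dim_ge_3
      idempotent_products_dim_2 idempotent_width_dim_2 length_eq_4_dim_2
    by (intro conjI impI)
qed

end
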